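(* For every integer $n\ge 2$, any essential cover of the $n$-dimensional hypercube $\{\pm 1\}^n$ consists of at least $10^{-2}\cdot n^{2/3}/(\log n)^{2/3}$ hyperplanes.
   Context: $\log$ denotes the natural logarithm. A collection of hyperplanes $h_1,\dots,h_k$ in $\mathbb{R}^n$, written $h_i=\{x\in\mathbb{R}^n : \langle v_i,x\rangle=\mu_i\}$ with $v_i=(v_{i1},\dots,v_{in})\in\mathbb{R}^n\setminus\{0\}$ and $\mu_i\in\mathbb{R}$, is an essential cover of $\{\pm1\}^n$ if: (E1) every $x\in\{\pm1\}^n$ lies in some $h_i$; (E2) for every $j\in[n]$ there is $i\in[k]$ with $v_{ij}\neq 0$; (E3) for every $i\in[k]$ there is $x\in\{\pm1\}^n$ lying in $h_i$ but in no $h_{i'}$ with $i'\neq i$. *)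

theory Defs
  imports "HOL-Analysis.Analysis"
begin

definition hypercube :: "nat \<Rightarrow> (nat \<Rightarrow> real) set" where
  "hypercube n = {x. (\<forall>j<n. x j = 1 \<or> x j = -1) \<and> (\<forall>j\<ge>n. x j = 0)}"

definition on_hyperplane :: "nat \<Rightarrow> (nat \<Rightarrow> real) \<Rightarrow> real \<Rightarrow> (nat \<Rightarrow> real) \<Rightarrow> bool" where
  "on_hyperplane n v mu x \<longleftrightarrow> (\<Sum>j<n. v j * x j) = mu"

definition essential_cover ::
  "nat \<Rightarrow> nat \<Rightarrow> (nat \<Rightarrow> nat \<Rightarrow> real) \<Rightarrow> (nat \<Rightarrow> real) \<Rightarrow> bool" where
  "essential_cover n k v mu \<longleftrightarrow>
     (\<forall>i<k. \<exists>j<n. v i j \<noteq> 0) \<and>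
     (\<forall>x\<in>hypercube n. \<exists>i<k. on_hyperplane n (v i) (mu i) x) \<and>
     (\<forall>j<n. \<exists>i<k. v i j \<noteq> 0) \<and>
     (\<forall>i<k. \<exists>x\<in>hypercube n. on_hyperplane n (v i) (mu i) x \<and>
        (\<forall>i'<k. i' \<noteq> i \<longrightarrow> \<not> on_hyperplane n (v i') (mu i') x))"

end

(*
  Every normal vector of an essential cover has at most 2k nonzero entries. If n were larger than
  a constant times k^(3/2) log n, the following yields an uncovered vertex.

  Say that a row v_i has few scales on a set T of columns if the magnitudes of its nonzero entries
  in T lie in O(log n) dyadic intervals, and that a column j of T is light if the sum of
  |v_ij| / ||v_i restricted to T||, over the rows with few scales on T, is O(1 / sqrt(log n)).
  Starting from all columns, delete columns that are not light. By Cauchy-Schwarz over the scales,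
  a row contributes only O(sqrt(k log n)) to all deletions together, so only
  O(k^(3/2) log n) columns are deleted, and a nonempty set T remains.

  Since some row is nonzero on T, there is a vertex y that avoids all hyperplanes whose normal
  vector vanishes on T; keep y outside T. Bang's lemma, applied to the rows with few scales, gives
  a point u in [-1/2,1/2]^T whose normalised distance from each of their hyperplanes is of order
  sqrt(log n). Now round u to a random vertex with expectation u. A row with few scales moves by
  less than this distance because of subgaussian concentration, and a row with many scales is hit
  with probability at most 1/n, because it has many entries all of whose signed sums are distinct.
*)
theory Submission
  imports Defs
begin

section \<open>Supports of the normal vectors\<close>

lemma sum_Pow_insert:
  assumes "finite P" "p \<notin> P"
  shows "sum f (Pow (insert p P)) = (\<Sum>S\<in>Pow P. f S + f (insert p S))"
proof -
  have "inj_on (insert p) (Pow P)"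
    using assms(2) by (auto simp: inj_on_def)
  moreover have "Pow P \<inter> insert p ` Pow P = {}"
    using assms(2) by auto
  ultimately show ?thesis
    using assms(1) by (simp add: Pow_insert sum.union_disjoint sum.reindex sum.distrib)
qed

text \<open>The product is a polynomial of degree at most \<open>card I\<close> in the indicators of
  the elements of \<open>S\<close>. The alternating sum is a \<open>card P\<close>-fold finite
  difference, which kills every smaller degree.\<close>

lemma alternating_sum_prod_affine:
  fixes \<alpha> :: "'i \<Rightarrow> 'a::comm_ring_1" and \<beta> :: "'i \<Rightarrow> 'b \<Rightarrow> 'a"
  assumes "finite P" "finite I" "card I < card P"
  shows "(\<Sum>S\<in>Pow P. (-1) ^ card S * (\<Prod>i\<in>I. \<alpha> i + (\<Sum>j\<in>S. \<beta> i j))) = 0"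
  using assms
proof (induction P arbitrary: I rule: finite_induct)
  case empty
  then show ?case by simp
next
  case (insert p P)
  define g where "g S i = \<alpha> i + (\<Sum>j\<in>S. \<beta> i j)" for S i
  \<comment> \<open>One difference, in direction \<open>p\<close>: the term \<open>X = I\<close> of
    the expansion cancels, so only products with fewer factors remain, as the induction
    requires.\<close>
  have step: "(-1) ^ card S * (\<Prod>i\<in>I. g S i)
        + (-1) ^ card (insert p S) * (\<Prod>i\<in>I. g (insert p S) i)
      = (\<Sum>X\<in>Pow I - {I}. - ((-1) ^ card S * (\<Prod>i\<in>X. g S i)) * (\<Prod>i\<in>I - X. \<beta> i p))"
    if "S \<in> Pow P" for S
  proof -
    have S: "finite S" "p \<notin> S"
      using that insert.hyps finite_subset by auto
    have "(\<Prod>i\<in>I. g (insert p S) i) = (\<Prod>i\<in>I. g S i + \<beta> i p)"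
      using S by (simp add: g_def algebra_simps)
    also have "\<dots> = (\<Sum>X\<in>Pow I. (\<Prod>i\<in>X. g S i) * (\<Prod>i\<in>I - X. \<beta> i p))"
      using insert.prems(1) by (rule prod_add)
    also have "\<dots> = (\<Prod>i\<in>I. g S i)
        + (\<Sum>X\<in>Pow I - {I}. (\<Prod>i\<in>X. g S i) * (\<Prod>i\<in>I - X. \<beta> i p))"
      using insert.prems(1) by (subst sum.remove[of _ I]) auto
    finally show ?thesis
      using S by (simp add: sum_distrib_left sum_negf algebra_simps)
  qed
  have zero: "(\<Sum>S\<in>Pow P. (-1) ^ card S * (\<Prod>i\<in>X. g S i)) = 0" if "X \<in> Pow I - {I}" for X
  proof -
    have "card X < card I"
      using that insert.prems(1) by (intro psubset_card_mono) auto
    then show ?thesis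
      unfolding g_def using that insert finite_subset[of X I] by (intro insert.IH) auto
  qed
  have "(\<Sum>S\<in>Pow (insert p P). (-1) ^ card S * (\<Prod>i\<in>I. g S i))
      = (\<Sum>S\<in>Pow P. \<Sum>X\<in>Pow I - {I}.
          - ((-1) ^ card S * (\<Prod>i\<in>X. g S i)) * (\<Prod>i\<in>I - X. \<beta> i p))"
    unfolding sum_Pow_insert[OF insert.hyps] by (intro sum.cong refl step)
  also have "\<dots> = (\<Sum>X\<in>Pow I - {I}. - (\<Sum>S\<in>Pow P. (-1) ^ card S * (\<Prod>i\<in>X. g S i))
          * (\<Prod>i\<in>I - X. \<beta> i p))"
    by (subst sum.swap) (simp add: sum_distrib_right sum_negf)
  also have "\<dots> = 0"
    using zero by simp
  finally show ?case
    by (simp add: g_def)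
qed

text \<open>The covering argument of Alon and Furedi: in the alternating sum only the term of the
  empty set survives, and it is the nonzero product of the \<open>\<alpha> i\<close>.\<close>

lemma card_le_of_cover_all_but_one:
  fixes \<alpha> :: "'i \<Rightarrow> 'a::idom"
  assumes "finite P" "finite I"
    and nz: "\<And>i. i \<in> I \<Longrightarrow> \<alpha> i \<noteq> 0"
    and cover: "\<And>S. S \<subseteq> P \<Longrightarrow> S \<noteq> {} \<Longrightarrow> \<exists>i\<in>I. \<alpha> i + (\<Sum>j\<in>S. \<beta> i j) = 0"
  shows "card P \<le> card I"
proof (rule ccontr)
  assume "\<not> card P \<le> card I"
  then have "0 = (\<Sum>S\<in>Pow P. (-1) ^ card S * (\<Prod>i\<in>I. \<alpha> i + (\<Sum>j\<in>S. \<beta> i j)))"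
    using assms by (subst alternating_sum_prod_affine) auto
  also have "\<dots> = (\<Sum>S\<in>{{}}. (-1) ^ card S * (\<Prod>i\<in>I. \<alpha> i + (\<Sum>j\<in>S. \<beta> i j)))"
    using assms by (intro sum.mono_neutral_right) auto
  also have "\<dots> = (\<Prod>i\<in>I. \<alpha> i)"
    by simp
  also have "\<dots> \<noteq> 0"
    using assms by auto
  finally show False
    by simp
qed

text \<open>
  Linial and Radhakrishnan: flipping coordinates with \<open>v\<^sub>i\<^sub>j x\<^sub>j\<close> of one sign leaves \<open>h\<^sub>i\<close>, so the
  other hyperplanes cover all vertices but one of the subcube in these coordinates.
\<close>
lemma essential_cover_card_support:
  assumes ec: "essential_cover n k v mu" and i: "i < k"
  shows "card {j \<in> {..<n}. v i j \<noteq> 0} \<le> 2 * k"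
proof -
  obtain x where x: "x \<in> hypercube n" "on_hyperplane n (v i) (mu i) x"
    and only: "\<And>i'. i' < k \<Longrightarrow> i' \<noteq> i \<Longrightarrow> \<not> on_hyperplane n (v i') (mu i') x"
    using ec i unfolding essential_cover_def by blast
  \<comment> \<open>Flipping a nonempty part of \<open>P\<close> leaves hyperplane \<open>i\<close>,
    so another hyperplane must cover the result, while none of the others contains \<open>x\<close>
    itself. Flipping coordinate \<open>j\<close> adds \<open>- 2 * (v i' j * x j)\<close> to the
    form of \<open>i'\<close>.\<close>
  have side: "card P \<le> k"
    if P: "P \<subseteq> {..<n}" and off: "\<And>S. S \<subseteq> P \<Longrightarrow> S \<noteq> {} \<Longrightarrow> (\<Sum>j\<in>S. v i j * x j) \<noteq> 0" for P
  proof -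
    have "card P \<le> card ({..<k} - {i})"
    proof (rule card_le_of_cover_all_but_one
        [where \<alpha> = "\<lambda>i'. (\<Sum>j<n. v i' j * x j) - mu i'" and \<beta> = "\<lambda>i' j. - 2 * (v i' j * x j)"])
      fix S assume S: "S \<subseteq> P" "S \<noteq> {}"
      define y where "y j = (if j \<in> S then - x j else x j)" for j
      have "y \<in> hypercube n"
        using x(1) by (auto simp: hypercube_def y_def)
      then obtain i' where i': "i' < k" "on_hyperplane n (v i') (mu i') y"
        using ec unfolding essential_cover_def by blast
      have sum_y: "(\<Sum>j<n. v l j * y j) = (\<Sum>j<n. v l j * x j) + (\<Sum>j\<in>S. - 2 * (v l j * x j))" for l
      proof -
        have "(\<Sum>j<n. v l j * y j)
            = (\<Sum>j<n. v l j * x j + (if j \<in> S then - 2 * (v l j * x j) else 0))"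
          by (intro sum.cong) (auto simp: y_def)
        also have "\<dots> = (\<Sum>j<n. v l j * x j) + (\<Sum>j\<in>{..<n} \<inter> S. - 2 * (v l j * x j))"
          unfolding sum.distrib by (subst sum.inter_restrict[symmetric]) auto
        also have "{..<n} \<inter> S = S"
          using S P by auto
        finally show ?thesis .
      qed
      have "i' \<noteq> i"
        using i'(2) x(2) off[OF S] sum_y[of i] by (auto simp: on_hyperplane_def sum_negf simp flip: sum_distrib_left)
      then show "\<exists>i'\<in>{..<k} - {i}. (\<Sum>j<n. v i' j * x j) - mu i' + (\<Sum>j\<in>S. - 2 * (v i' j * x j)) = 0"
        using i' sum_y[of i'] by (intro bexI[of _ i']) (auto simp: on_hyperplane_def)
    qed (use P only finite_subset in \<open>auto simp: on_hyperplane_def\<close>)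
    also have "\<dots> \<le> k"
      using i by simp
    finally show ?thesis .
  qed
  \<comment> \<open>Summands of one sign cannot cancel, so \<open>side\<close> applies to each of
    the two sign classes; hence the factor 2.\<close>
  define A where "A = {j \<in> {..<n}. v i j * x j > 0}"
  define B where "B = {j \<in> {..<n}. v i j * x j < 0}"
  have "card A \<le> k"
  proof (rule side)
    fix S assume S: "S \<subseteq> A" "S \<noteq> {}"
    then have "(\<Sum>j\<in>S. v i j * x j) > 0"
      by (intro sum_pos) (auto simp: A_def intro: finite_subset[of _ "{..<n}"])
    then show "(\<Sum>j\<in>S. v i j * x j) \<noteq> 0"
      by simp
  qed (auto simp: A_def)
  moreover have "card B \<le> k"
  proof (rule side)
    fix S assume S: "S \<subseteq> B" "S \<noteq> {}"
    then have "(\<Sum>j\<in>S. - (v i j * x j)) > 0"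
      by (intro sum_pos) (auto simp: B_def intro: finite_subset[of _ "{..<n}"])
    then show "(\<Sum>j\<in>S. v i j * x j) \<noteq> 0"
      by (simp add: sum_negf)
  qed (auto simp: B_def)
  moreover have "{j \<in> {..<n}. v i j \<noteq> 0} \<subseteq> A \<union> B"
  proof
    fix j assume j: "j \<in> {j \<in> {..<n}. v i j \<noteq> 0}"
    then have "x j \<noteq> 0"
      using x(1) by (force simp: hypercube_def)
    then show "j \<in> A \<union> B"
      using j by (auto simp: A_def B_def mult_less_0_iff zero_less_mult_iff)
  qed
  then have "card {j \<in> {..<n}. v i j \<noteq> 0} \<le> card (A \<union> B)"
    by (intro card_mono) (auto simp: A_def B_def)
  moreover have "card (A \<union> B) \<le> card A + card B"
    by (rule card_Un_le)
  ultimately show ?thesis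
    by simp
qed

section \<open>Bang's lemma\<close>

definition pm :: "'a set \<Rightarrow> 'a \<Rightarrow> real" where
  "pm S j = (if j \<in> S then 1 else -1)"

text \<open>For a Gram matrix \<open>M\<close>, this gives a signed sum of the vectors that stays
  away from one prescribed hyperplane per vector, with the diagonal measuring how far.\<close>

lemma Bang:
  fixes M :: "'i \<Rightarrow> 'i \<Rightarrow> real"
  assumes fin: "finite I" and sym: "\<And>i j. i \<in> I \<Longrightarrow> j \<in> I \<Longrightarrow> M i j = M j i"
  obtains \<epsilon> where "\<And>i. \<epsilon> i = 1 \<or> \<epsilon> i = -1"
    and "\<And>i. i \<in> I \<Longrightarrow> \<bar>(\<Sum>j\<in>I. M i j * \<epsilon> j) - m i\<bar> \<ge> M i i"
proof -
  \<comment> \<open>a maximiser of \<open>Q\<close> works: compare it with the vectors that differ in one sign\<close>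
  define Q where "Q e = (\<Sum>i\<in>I. \<Sum>j\<in>I. M i j * e i * e j) - 2 * (\<Sum>i\<in>I. m i * e i)" for e
  obtain S where S: "\<And>S'. S' \<subseteq> I \<Longrightarrow> Q (pm S') \<le> Q (pm S)" "S \<subseteq> I"
  proof -
    have fin': "finite ((\<lambda>S. Q (pm S)) ` Pow I)"
      using fin by simp
    have "Max ((\<lambda>S. Q (pm S)) ` Pow I) \<in> (\<lambda>S. Q (pm S)) ` Pow I"
      using fin' by (intro Max_in) auto
    then obtain S where "S \<in> Pow I" "Max ((\<lambda>S. Q (pm S)) ` Pow I) = Q (pm S)"
      by blast
    moreover have "Q (pm S') \<le> Max ((\<lambda>S. Q (pm S)) ` Pow I)" if "S' \<subseteq> I" for S'
      using fin' that by (intro Max_ge) auto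
    ultimately show thesis
      by (intro that[of S]) auto
  qed
  have "\<bar>(\<Sum>j\<in>I. M i j * pm S j) - m i\<bar> \<ge> M i i" if i: "i \<in> I" for i
  proof -
    define S' where "S' = (if i \<in> S then S - {i} else insert i S)"
    define r where "r = (\<Sum>j\<in>I - {i}. M i j * pm S j)"
    \<comment> \<open>Isolates the dependence on \<open>e i\<close>: the diagonal term is the same
      for both signs, so only the linear term reacts to the flip.\<close>
    have Q_eq: "Q e = M i i * (e i * e i) + 2 * e i * (\<Sum>j\<in>I - {i}. M i j * e j) - 2 * m i * e i
        + (\<Sum>a\<in>I - {i}. \<Sum>b\<in>I - {i}. M a b * e a * e b) - 2 * (\<Sum>a\<in>I - {i}. m a * e a)" for e
    proof -
      have sw: "(\<Sum>a\<in>I - {i}. M a i * e a * e i) = e i * (\<Sum>j\<in>I - {i}. M i j * e j)"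
        using sym i by (auto simp: sum_distrib_left intro!: sum.cong)
      have "(\<Sum>a\<in>I. \<Sum>b\<in>I. M a b * e a * e b)
          = (\<Sum>b\<in>I. M i b * e i * e b) + (\<Sum>a\<in>I - {i}. M a i * e a * e i + (\<Sum>b\<in>I - {i}. M a b * e a * e b))"
        using fin i by (simp add: sum.remove[of I i])
      also have "(\<Sum>b\<in>I. M i b * e i * e b) = M i i * (e i * e i) + e i * (\<Sum>j\<in>I - {i}. M i j * e j)"
        using fin i by (simp add: sum.remove[of I i] sum_distrib_left mult_ac)
      finally show ?thesis
        using fin i sw by (simp add: Q_def sum.remove[of I i] sum.distrib algebra_simps)
    qed
    have sg: "pm S' i = - pm S i" "\<And>j. j \<in> I \<Longrightarrow> j \<noteq> i \<Longrightarrow> pm S' j = pm S j"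
      by (auto simp: pm_def S'_def)
    have "Q (pm S') = Q (pm S) - 4 * pm S i * (r - m i)"
      unfolding Q_eq[of "pm S'"] Q_eq[of "pm S"] r_def sg(1) using sg(2)
      by (simp add: algebra_simps cong: sum.cong_simp)
    moreover have "Q (pm S') \<le> Q (pm S)"
      using S i by (intro S(1)) (auto simp: S'_def)
    \<comment> \<open>Hence \<open>pm S i\<close> times the full deviation is
      \<open>M i i + pm S i * (r - m i)\<close>, which is at least \<open>M i i\<close>.\<close>
    ultimately have "pm S i * (r - m i) \<ge> 0"
      by simp
    moreover have "(\<Sum>j\<in>I. M i j * pm S j) = M i i * pm S i + r"
      using fin i by (simp add: sum.remove[of I i] r_def)
    ultimately show ?thesis
      by (auto simp: pm_def split: if_splits)
  qed
  then show thesis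
    by (intro that[of "pm S"]) (auto simp: pm_def)
qed

section \<open>Random signs\<close>

text \<open>
  A set \<open>S \<subseteq> T\<close> encodes the sign vector \<open>pm S\<close>; under \<open>weight T u\<close> the signs are independent
  with expectations \<open>u\<close>.
\<close>
definition weight :: "'a set \<Rightarrow> ('a \<Rightarrow> real) \<Rightarrow> 'a set \<Rightarrow> real" where
  "weight T u S = (\<Prod>j\<in>T. (1 + u j * pm S j) / 2)"

definition prob :: "'a set \<Rightarrow> ('a \<Rightarrow> real) \<Rightarrow> ('a set \<Rightarrow> bool) \<Rightarrow> real" where
  "prob T u E = (\<Sum>S | S \<subseteq> T \<and> E S. weight T u S)"

text \<open>Independence of the signs: it yields both the total mass 1 and the factorisation of
  exponential moments.\<close>

lemma sum_Pow_prod_sign: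
  assumes "finite T"
  shows "(\<Sum>S\<in>Pow T. \<Prod>j\<in>T. g j (pm S j)) = (\<Prod>j\<in>T. g j 1 + g j (-1) :: real)"
  using assms
proof (induction T rule: finite_induct)
  case (insert t T)
  have 1: "(\<Prod>j\<in>T. g j (pm (insert t S) j)) = (\<Prod>j\<in>T. g j (pm S j))" for S
    using insert.hyps by (intro prod.cong) (auto simp: pm_def)
  have "(\<Sum>S\<in>Pow (insert t T). \<Prod>j\<in>insert t T. g j (pm S j))
      = (\<Sum>S\<in>Pow T. (g t 1 + g t (-1)) * (\<Prod>j\<in>T. g j (pm S j)))"
    unfolding sum_Pow_insert[OF insert.hyps] using insert.hyps
    by (intro sum.cong) (auto simp: 1 algebra_simps pm_def[of _ t])
  also have "\<dots> = (g t 1 + g t (-1)) * (\<Prod>j\<in>T. g j 1 + g j (-1))"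
    by (simp add: insert.IH flip: sum_distrib_left)
  finally show ?case
    using insert.hyps by simp
qed simp

lemma sum_weight:
  assumes "finite T"
  shows "(\<Sum>S\<in>Pow T. weight T u S) = 1"
  using sum_Pow_prod_sign[OF assms, of "\<lambda>j s. (1 + u j * s) / 2"]
  by (simp add: weight_def field_simps)

lemma weight_nonneg:
  assumes "\<And>j. j \<in> T \<Longrightarrow> \<bar>u j\<bar> \<le> 1"
  shows "weight T u S \<ge> 0"
  unfolding weight_def
proof (intro prod_nonneg)
  fix j assume "j \<in> T"
  then show "(1 + u j * pm S j) / 2 \<ge> 0"
    using assms[of j] by (auto simp: pm_def)
qed

lemma prob_eq:
  assumes "finite T"
  shows "prob T u E = (\<Sum>S\<in>Pow T. if E S then weight T u S else 0)"
  using assms unfolding prob_def by (subst sum.inter_filter[symmetric]) (auto intro: sum.cong)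

text \<open>Union bound: if every \<open>S\<close> were hit by some event, the probabilities would
  add up to at least the total mass 1.\<close>

lemma exists_avoiding:
  assumes "finite T" "finite I" and "(\<Sum>i\<in>I. prob T u (E i)) < 1"
    and "\<And>j. j \<in> T \<Longrightarrow> \<bar>u j\<bar> \<le> 1"
  obtains S where "S \<subseteq> T" "\<And>i. i \<in> I \<Longrightarrow> \<not> E i S"
proof -
  have "\<exists>S\<subseteq>T. \<forall>i\<in>I. \<not> E i S"
  proof (rule ccontr)
    assume "\<not> ?thesis"
    then have hit: "\<exists>i\<in>I. E i S" if "S \<subseteq> T" for S
      using that by blast
    have "1 = (\<Sum>S\<in>Pow T. weight T u S)"
      using assms(1) by (simp add: sum_weight)
    also have "\<dots> \<le> (\<Sum>S\<in>Pow T. \<Sum>i\<in>I. if E i S then weight T u S else 0)"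
    proof (rule sum_mono)
      fix S assume "S \<in> Pow T"
      then obtain i where i: "i \<in> I" "E i S"
        using hit by blast
      have "weight T u S = (if E i S then weight T u S else 0)"
        using i by simp
      also have "\<dots> \<le> (\<Sum>i\<in>I. if E i S then weight T u S else 0)"
        using i assms(2) weight_nonneg[OF assms(4)] by (intro member_le_sum) auto
      finally show "weight T u S \<le> (\<Sum>i\<in>I. if E i S then weight T u S else 0)" .
    qed
    also have "\<dots> = (\<Sum>i\<in>I. prob T u (E i))"
      unfolding prob_eq[OF assms(1)] by (rule sum.swap)
    finally show False
      using assms(3) by simp
  qed
  then show thesis
    using that by blast
qed

section \<open>Subgaussian concentration of biased signs\<close>

text \<open>In this form the linear term averages to zero for a centred variable and only the
  Gaussian-type term is left.\<close>

lemma exp_le_add_exp_square: "exp y \<le> y + exp (y\<^sup>2)" for y :: real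
proof (cases "y \<le> 1")
  case True
  have "exp y \<le> 1 + y + y\<^sup>2"
  proof (cases "y \<ge> 0")
    case True
    then show ?thesis
      using exp_bound \<open>y \<le> 1\<close> by blast
  next
    case False
    define z where "z = - y"
    have z: "z > 0"
      using False by (simp add: z_def)
    \<comment> \<open>The product equals \<open>1 + z ^ 3\<close>.\<close>
    have "1 \<le> (1 - z + z\<^sup>2) * (1 + z)"
      using z by (simp add: algebra_simps power2_eq_square)
    also have "\<dots> \<le> (1 - z + z\<^sup>2) * exp z"
    proof (rule mult_left_mono)
      have "1 - z + z\<^sup>2 = (1 - z / 2)\<^sup>2 + 3 / 4 * z\<^sup>2"
        by (simp add: power2_eq_square field_simps)
      then show "0 \<le> 1 - z + z\<^sup>2"
        by simp
    qed (simp add: exp_ge_add_one_self)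
    finally show ?thesis
      by (simp add: z_def exp_minus field_simps)
  qed
  also have "\<dots> \<le> y + exp (y\<^sup>2)"
    using exp_ge_add_one_self[of "y\<^sup>2"] by simp
  finally show ?thesis .
next
  case False
  then have "y \<le> y\<^sup>2"
    by (simp add: power2_eq_square)
  then have "exp y \<le> exp (y\<^sup>2)"
    by simp
  then show ?thesis
    using False by linarith
qed

text \<open>The centred sign takes the values \<open>1 - u\<close> and \<open>-1 - u\<close>, both
  at most 3/2 in absolute value, whence 9/4; the linear terms of the previous bound cancel.\<close>

lemma mgf_biased_sign:
  fixes u c :: real
  assumes "\<bar>u\<bar> \<le> 1 / 2"
  shows "(1 + u) / 2 * exp (c * (1 - u)) + (1 - u) / 2 * exp (c * (-1 - u)) \<le> exp (9 / 4 * c\<^sup>2)"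
proof -
  have b: "exp (c * w) \<le> c * w + exp (9 / 4 * c\<^sup>2)" if "\<bar>w\<bar> \<le> 3 / 2" for w
  proof -
    have "w\<^sup>2 \<le> (3 / 2)\<^sup>2"
      using power_mono[OF that, of 2] by simp
    then have "(c * w)\<^sup>2 \<le> 9 / 4 * c\<^sup>2"
      using mult_left_mono[of "w\<^sup>2" "9 / 4" "c\<^sup>2"]
      by (simp add: power_mult_distrib power_divide mult.commute)
    then show ?thesis
      using exp_le_add_exp_square[of "c * w"] by (smt (verit) exp_le_cancel_iff)
  qed
  have "(1 + u) / 2 * exp (c * (1 - u)) + (1 - u) / 2 * exp (c * (-1 - u))
      \<le> (1 + u) / 2 * (c * (1 - u) + exp (9 / 4 * c\<^sup>2)) + (1 - u) / 2 * (c * (-1 - u) + exp (9 / 4 * c\<^sup>2))"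
    using assms by (intro add_mono mult_left_mono b) auto
  also have "\<dots> = exp (9 / 4 * c\<^sup>2)"
    by (simp add: field_simps)
  finally show ?thesis .
qed

text \<open>Chernoff's method: bound the indicator by an exponential and factor the exponential
  moment over the coordinates.\<close>

lemma prob_upper_tail:
  assumes T: "finite T" and u: "\<And>j. j \<in> T \<Longrightarrow> \<bar>u j\<bar> \<le> 1 / 2"
    and a: "(\<Sum>j\<in>T. (a j)\<^sup>2) \<le> 1" and \<theta>: "\<theta> > 0"
  shows "prob T u (\<lambda>S. (\<Sum>j\<in>T. a j * (pm S j - u j)) \<ge> \<theta>) \<le> exp (- (\<theta>\<^sup>2 / 9))"
proof -
  \<comment> \<open>Minimises the resulting exponent
    \<open>9 / 4 * c\<^sup>2 - c * \<theta>\<close>.\<close>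
  define c where "c = 2 * \<theta> / 9"
  define X where "X S = (\<Sum>j\<in>T. a j * (pm S j - u j))" for S
  have w: "weight T u S \<ge> 0" for S
    using u by (intro weight_nonneg) force
  have "prob T u (\<lambda>S. X S \<ge> \<theta>) \<le> (\<Sum>S\<in>Pow T. weight T u S * exp (c * (X S - \<theta>)))"
    unfolding prob_eq[OF T]
  proof (rule sum_mono)
    fix S
    have "1 \<le> exp (c * (X S - \<theta>))" if "X S \<ge> \<theta>"
      using that \<theta> by (simp add: c_def)
    then show "(if X S \<ge> \<theta> then weight T u S else 0) \<le> weight T u S * exp (c * (X S - \<theta>))"
      using w[of S] by (auto simp: mult_le_cancel_left1)
  qed
  also have "\<dots> = exp (- (c * \<theta>)) * (\<Sum>S\<in>Pow T. weight T u S * exp (c * X S))"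
    by (simp add: sum_distrib_left exp_diff exp_minus right_diff_distrib field_simps)
  also have "(\<Sum>S\<in>Pow T. weight T u S * exp (c * X S))
      = (\<Sum>S\<in>Pow T. \<Prod>j\<in>T. (1 + u j * pm S j) / 2 * exp (c * a j * (pm S j - u j)))"
    unfolding weight_def X_def using T
    by (simp add: exp_sum sum_distrib_left mult.assoc flip: prod.distrib)
  also have "\<dots> = (\<Prod>j\<in>T. (1 + u j) / 2 * exp (c * a j * (1 - u j))
      + (1 - u j) / 2 * exp (c * a j * (-1 - u j)))"
    using sum_Pow_prod_sign[OF T, of "\<lambda>j s. (1 + u j * s) / 2 * exp (c * a j * (s - u j))"] by simp
  also have "\<dots> \<le> (\<Prod>j\<in>T. exp (9 / 4 * (c * a j)\<^sup>2))"
  proof (rule prod_mono)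
    fix j assume j: "j \<in> T"
    show "0 \<le> (1 + u j) / 2 * exp (c * a j * (1 - u j)) + (1 - u j) / 2 * exp (c * a j * (-1 - u j)) \<and>
      (1 + u j) / 2 * exp (c * a j * (1 - u j)) + (1 - u j) / 2 * exp (c * a j * (-1 - u j))
        \<le> exp (9 / 4 * (c * a j)\<^sup>2)"
      using u[OF j] by (intro conjI mgf_biased_sign add_nonneg_nonneg mult_nonneg_nonneg) auto
  qed
  also have "\<dots> = exp (9 / 4 * c\<^sup>2 * (\<Sum>j\<in>T. (a j)\<^sup>2))"
    using T by (simp add: exp_sum sum_distrib_left power_mult_distrib mult.assoc)
  also have "\<dots> \<le> exp (9 / 4 * c\<^sup>2 * 1)"
    using a by (subst exp_le_cancel_iff, intro mult_left_mono) auto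
  finally have "prob T u (\<lambda>S. X S \<ge> \<theta>) \<le> exp (- (c * \<theta>)) * exp (9 / 4 * c\<^sup>2)"
    by simp
  also have "\<dots> = exp (- (\<theta>\<^sup>2 / 9))"
    by (simp add: c_def power2_eq_square flip: exp_add)
  finally show ?thesis
    by (simp add: X_def)
qed

lemma prob_abs_ge:
  assumes T: "finite T" and u: "\<And>j. j \<in> T \<Longrightarrow> \<bar>u j\<bar> \<le> 1 / 2"
    and a: "(\<Sum>j\<in>T. (a j)\<^sup>2) \<le> 1" and \<theta>: "\<theta> > 0"
  shows "prob T u (\<lambda>S. \<bar>\<Sum>j\<in>T. a j * (pm S j - u j)\<bar> \<ge> \<theta>) \<le> 2 * exp (- (\<theta>\<^sup>2 / 9))"
proof -
  have w: "weight T u S \<ge> 0" for S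
    using u by (intro weight_nonneg) force
  have "prob T u (\<lambda>S. \<bar>\<Sum>j\<in>T. a j * (pm S j - u j)\<bar> \<ge> \<theta>)
     \<le> prob T u (\<lambda>S. (\<Sum>j\<in>T. a j * (pm S j - u j)) \<ge> \<theta>)
      + prob T u (\<lambda>S. (\<Sum>j\<in>T. (- a j) * (pm S j - u j)) \<ge> \<theta>)"
    unfolding prob_eq[OF T] sum.distrib[symmetric]
    using w by (intro sum_mono) (auto simp: sum_negf)
  also have "\<dots> \<le> exp (- (\<theta>\<^sup>2 / 9)) + exp (- (\<theta>\<^sup>2 / 9))"
    using assms by (intro add_mono prob_upper_tail) auto
  finally show ?thesis
    by simp
qed

section \<open>Anticoncentration of sums whose entries have many scales\<close>

text \<open>Conditioning on the sign at \<open>t\<close>, which only shifts the target value for the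
  remaining sum.\<close>

lemma prob_insert_sum_eq:
  assumes "finite T" "t \<notin> T"
  shows "prob (insert t T) u (\<lambda>S. (\<Sum>j\<in>insert t T. a j * pm S j) = m)
    = (1 + u t) / 2 * prob T u (\<lambda>S. (\<Sum>j\<in>T. a j * pm S j) = m - a t)
    + (1 - u t) / 2 * prob T u (\<lambda>S. (\<Sum>j\<in>T. a j * pm S j) = m + a t)"
proof -
  have pm_insert: "pm (insert t S) j = pm S j" if "j \<in> T" for S j
    using that assms by (auto simp: pm_def)
  have pm_t: "pm S t = -1" "pm (insert t S) t = 1" if "S \<in> Pow T" for S
    using that assms by (auto simp: pm_def)
  have w: "weight (insert t T) u S = (1 - u t) / 2 * weight T u S"
      "weight (insert t T) u (insert t S) = (1 + u t) / 2 * weight T u S" if "S \<in> Pow T" for S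
    using assms pm_t[OF that] by (simp_all add: weight_def pm_insert cong: prod.cong_simp)
  have "prob (insert t T) u (\<lambda>S. (\<Sum>j\<in>insert t T. a j * pm S j) = m)
    = (\<Sum>S\<in>Pow T. (1 + u t) / 2 * (if (\<Sum>j\<in>T. a j * pm S j) = m - a t then weight T u S else 0)
      + (1 - u t) / 2 * (if (\<Sum>j\<in>T. a j * pm S j) = m + a t then weight T u S else 0))"
    unfolding prob_eq[OF finite.insertI[OF assms(1)]] sum_Pow_insert[OF assms]
  proof (intro sum.cong refl)
    fix S assume S: "S \<in> Pow T"
    have "(\<Sum>j\<in>insert t T. a j * pm S j) = (\<Sum>j\<in>T. a j * pm S j) - a t"
      "(\<Sum>j\<in>insert t T. a j * pm (insert t S) j) = (\<Sum>j\<in>T. a j * pm S j) + a t"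
      using assms pm_t[OF S] by (simp_all add: pm_insert cong: sum.cong_simp)
    then show "(if (\<Sum>j\<in>insert t T. a j * pm S j) = m then weight (insert t T) u S else 0)
        + (if (\<Sum>j\<in>insert t T. a j * pm (insert t S) j) = m then weight (insert t T) u (insert t S) else 0)
      = (1 + u t) / 2 * (if (\<Sum>j\<in>T. a j * pm S j) = m - a t then weight T u S else 0)
        + (1 - u t) / 2 * (if (\<Sum>j\<in>T. a j * pm S j) = m + a t then weight T u S else 0)"
      by (simp add: w[OF S] diff_eq_eq eq_diff_eq add.commute)
  qed
  then show ?thesis
    by (simp add: prob_eq[OF assms(1)] sum.distrib sum_distrib_left)
qed

text \<open>Distinct exponents of equal parity differ by at least 2, so the entries are dominated by
  a geometric series of ratio 1/4.\<close>

lemma sum_abs_less_of_sparse_scales: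
  fixes a :: "'a \<Rightarrow> real" and e :: "'a \<Rightarrow> int"
  assumes "finite J" "inj_on e J"
    and "\<And>j. j \<in> J \<Longrightarrow> \<bar>a j\<bar> < 2 powr (e j + 1)"
    and "\<And>j. j \<in> J \<Longrightarrow> e j \<le> E \<and> even (E - e j)"
  shows "(\<Sum>j\<in>J. \<bar>a j\<bar>) < 2 powr (E + 2)"
  using assms
proof (induction J arbitrary: E rule: finite_ranking_induct[where f = e])
  case (insert x S)
  show ?case
  \<comment> \<open>The ranking induction adds elements by increasing \<open>e\<close> but does not
    promise that \<open>x\<close> is new.\<close>
  proof (cases "x \<in> S")
    case True
    then show ?thesis
      using insert.prems by (simp add: insert_absorb insert.IH)
  next
    case False
    \<comment> \<open>The earlier entries sum to less than \<open>2 powr e x\<close>; with the entry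
      at \<open>x\<close> this stays below three times that power, and four times is
      allowed.\<close>
    have "(\<Sum>j\<in>S. \<bar>a j\<bar>) < 2 powr (of_int (e x - 2) + 2)"
    proof (rule insert.IH)
      fix j assume j: "j \<in> S"
      have "e j \<noteq> e x"
        using j False insert.prems(1) by (auto simp: inj_on_def)
      moreover have "even (e x - e j)"
        using insert.prems(3)[of x] insert.prems(3)[of j] j by auto
      ultimately show "e j \<le> e x - 2 \<and> even (e x - 2 - e j)"
        using insert.hyps(2)[OF j] by presburger
    qed (use insert.prems in auto)
    moreover have "\<bar>a x\<bar> < 2 powr (e x + 1)"
      using insert.prems(2) by simp
    moreover have "2 powr (e x + 2) \<le> 2 powr (real_of_int E + 2)"
      using insert.prems(3)[of x] by simp
    moreover have "2 powr (real_of_int (e x) + 1) = 2 * 2 powr e x" "2 powr (real_of_int (e x) + 2) = 4 * 2 powr e x"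
      by (simp_all add: powr_add)
    moreover have "0 < (2 :: real) powr e x"
      by simp
    moreover have "(\<Sum>j\<in>insert x S. \<bar>a j\<bar>) = \<bar>a x\<bar> + (\<Sum>j\<in>S. \<bar>a j\<bar>)"
      using False insert.hyps(1) by simp
    ultimately show ?thesis
      by simp
  qed
qed simp

text \<open>The entry of largest scale exceeds the sum of all others, so its sign is forced by the
  target value. Each sign has probability at most 3/4 given the others, and the induction gains this
  factor per entry.\<close>

lemma prob_sparse_scales:
  fixes a :: "'a \<Rightarrow> real" and e :: "'a \<Rightarrow> int"
  assumes "finite J" "inj_on e J"
    and "\<And>j. j \<in> J \<Longrightarrow> 2 powr e j \<le> \<bar>a j\<bar> \<and> \<bar>a j\<bar> < 2 powr (e j + 1)"
    and "\<And>i j. i \<in> J \<Longrightarrow> j \<in> J \<Longrightarrow> even (e i - e j)"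
    and "\<And>j. j \<in> J \<Longrightarrow> \<bar>u j\<bar> \<le> 1 / 2"
  shows "prob J u (\<lambda>S. (\<Sum>j\<in>J. a j * pm S j) = m) \<le> (3 / 4) ^ card J"
  using assms
proof (induction J arbitrary: m rule: finite_ranking_induct[where f = e])
  case empty
  then show ?case
    unfolding prob_eq[OF finite.emptyI] Pow_empty by (simp add: weight_def)
next
  case (insert t J)
  show ?case
  proof (cases "t \<in> J")
    case True
    then have eq: "insert t J = J"
      by auto
    show ?thesis
      using insert.prems unfolding eq by (intro insert.IH)
  next
    case False
    have IH: "prob J u (\<lambda>S. (\<Sum>j\<in>J. a j * pm S j) = m) \<le> (3 / 4) ^ card J" for m
      using insert.prems by (intro insert.IH) auto
    have "(\<Sum>j\<in>J. \<bar>a j\<bar>) < 2 powr (of_int (e t - 2) + 2)"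
    proof (rule sum_abs_less_of_sparse_scales)
      fix j assume j: "j \<in> J"
      have "e j \<noteq> e t"
        using j False insert.prems(1) by (auto simp: inj_on_def)
      moreover have "even (e t - e j)"
        using insert.prems(3)[of t j] j by auto
      ultimately show "e j \<le> e t - 2 \<and> even (e t - 2 - e j)"
        using insert.hyps(2)[OF j] by presburger
    qed (use insert in auto)
    also have "\<dots> \<le> \<bar>a t\<bar>"
      using insert.prems(2)[of t] by simp
    finally have less: "(\<Sum>j\<in>J. \<bar>a j\<bar>) < \<bar>a t\<bar>" .
    have zero: "prob J u (\<lambda>S. (\<Sum>j\<in>J. a j * pm S j) = m) = 0" if "\<bar>m\<bar> \<ge> \<bar>a t\<bar>" for m
    proof -
      have "\<bar>\<Sum>j\<in>J. a j * pm S j\<bar> \<le> (\<Sum>j\<in>J. \<bar>a j\<bar>)" for S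
        by (rule order_trans[OF sum_abs]) (auto simp: pm_def abs_mult intro!: sum_mono)
      then have "(\<Sum>j\<in>J. a j * pm S j) \<noteq> m" for S
        using that less by (metis linorder_not_less order_less_le_trans)
      then show ?thesis
        by (simp add: prob_def)
    qed
    have ut: "\<bar>u t\<bar> \<le> 1 / 2"
      using insert.prems(4) by simp
    have nonneg: "prob J u (\<lambda>S. (\<Sum>j\<in>J. a j * pm S j) = m) \<ge> 0" for m
      unfolding prob_def using insert.prems(4)
      by (intro sum_nonneg weight_nonneg) force
    have half: "c / 2 * prob J u (\<lambda>S. (\<Sum>j\<in>J. a j * pm S j) = m) \<le> 3 / 4 * (3 / 4) ^ card J"
      if "c \<le> 3 / 2" for c m
      using that nonneg by (intro mult_mono IH) auto
    \<comment> \<open>at most one sign of the dominant entry is compatible with the value \<open>m\<close>\<close>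
    have "\<bar>m - a t\<bar> \<ge> \<bar>a t\<bar> \<or> \<bar>m + a t\<bar> \<ge> \<bar>a t\<bar>"
      by linarith
    then have "prob (insert t J) u (\<lambda>S. (\<Sum>j\<in>insert t J. a j * pm S j) = m) \<le> 3 / 4 * (3 / 4) ^ card J"
    proof
      assume "\<bar>m - a t\<bar> \<ge> \<bar>a t\<bar>"
      then show ?thesis
        unfolding prob_insert_sum_eq[OF insert.hyps(1) False]
        using ut half[of "1 - u t" "m + a t"] by (simp only: zero) linarith
    next
      assume "\<bar>m + a t\<bar> \<ge> \<bar>a t\<bar>"
      then show ?thesis
        unfolding prob_insert_sum_eq[OF insert.hyps(1) False]
        using ut half[of "1 + u t" "m - a t"] by (simp only: zero) linarith
    qed
    then show ?thesis
      using False insert.hyps(1) by simp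
  qed
qed

text \<open>Conditioning on the signs outside \<open>J\<close> only shifts the target, and the
  assumed bound is uniform in the target.\<close>

lemma prob_sum_eq_superset:
  assumes T: "finite T" and J: "J \<subseteq> T" and u: "\<And>j. j \<in> T \<Longrightarrow> \<bar>u j\<bar> \<le> 1"
    and bound: "\<And>m. prob J u (\<lambda>S. (\<Sum>j\<in>J. a j * pm S j) = m) \<le> q"
  shows "prob T u (\<lambda>S. (\<Sum>j\<in>T. a j * pm S j) = m) \<le> q"
proof -
  have "prob (J \<union> K) u (\<lambda>S. (\<Sum>j\<in>J \<union> K. a j * pm S j) = m) \<le> q" if "finite K" "K \<subseteq> T - J" for K m
    using that
  proof (induction K arbitrary: m rule: finite_induct)
    case empty
    then show ?case
      using bound by simp
  next
    case (insert t K)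
    have fin: "finite (J \<union> K)" "t \<notin> J \<union> K"
      using insert J T finite_subset by auto
    have "\<bar>u t\<bar> \<le> 1"
      using u insert.prems by auto
    then have "prob (insert t (J \<union> K)) u (\<lambda>S. (\<Sum>j\<in>insert t (J \<union> K). a j * pm S j) = m)
        \<le> (1 + u t) / 2 * q + (1 - u t) / 2 * q"
      unfolding prob_insert_sum_eq[OF fin] using insert.prems
      by (intro add_mono mult_left_mono insert.IH) auto
    then show ?case
      by (simp add: field_simps)
  qed
  from this[of "T - J"] show ?thesis
    using T J by (simp add: Un_absorb1)
qed

definition scale :: "real \<Rightarrow> int" where
  "scale x = \<lfloor>log 2 \<bar>x\<bar>\<rfloor>"

lemma scale_bounds:
  assumes "x \<noteq> 0"
  shows "2 powr scale x \<le> \<bar>x\<bar>" "\<bar>x\<bar> < 2 powr (scale x + 1)"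
proof -
  have "\<bar>x\<bar> = 2 powr log 2 \<bar>x\<bar>"
    using assms by simp
  moreover have "2 powr scale x \<le> 2 powr log 2 \<bar>x\<bar>" "2 powr log 2 \<bar>x\<bar> < 2 powr (scale x + 1)"
    unfolding scale_def by (intro powr_mono powr_less_mono; linarith)+
  ultimately show "2 powr scale x \<le> \<bar>x\<bar>" "\<bar>x\<bar> < 2 powr (scale x + 1)"
    by simp_all
qed

definition scales :: "('a \<Rightarrow> real) \<Rightarrow> 'a set \<Rightarrow> int set" where
  "scales a T = (\<lambda>j. scale (a j)) ` {j \<in> T. a j \<noteq> 0}"

text \<open>One parity class contains at least \<open>D\<close> of the scales; choose one entry per
  scale of this class and condition on all other signs.\<close>

lemma prob_many_scales:
  assumes T: "finite T" and u: "\<And>j. j \<in> T \<Longrightarrow> \<bar>u j\<bar> \<le> 1 / 2"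
    and D: "2 * D \<le> card (scales a T)"
  shows "prob T u (\<lambda>S. (\<Sum>j\<in>T. a j * pm S j) = m) \<le> (3 / 4) ^ D"
proof -
  have fin: "finite (scales a T)"
    using T by (simp add: scales_def)
  \<comment> \<open>with scales of one parity, every entry exceeds the sum of all entries of smaller scale\<close>
  have "scales a T = {e \<in> scales a T. even e} \<union> {e \<in> scales a T. odd e}"
    by auto
  then have "2 * D \<le> card {e \<in> scales a T. even e} + card {e \<in> scales a T. odd e}"
    using D card_Un_le by (metis (no_types, lifting) order_trans)
  then have "D \<le> card {e \<in> scales a T. even e} \<or> D \<le> card {e \<in> scales a T. odd e}"
    by linarith
  then obtain E where E: "E \<subseteq> scales a T" "D \<le> card E" "\<And>d e. d \<in> E \<Longrightarrow> e \<in> E \<Longrightarrow> even (d - e)"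
  proof (elim disjE)
    assume "D \<le> card {e \<in> scales a T. even e}"
    then show thesis
      by (intro that[of "{e \<in> scales a T. even e}"]) auto
  next
    assume "D \<le> card {e \<in> scales a T. odd e}"
    then show thesis
      by (intro that[of "{e \<in> scales a T. odd e}"]) auto
  qed
  then obtain J where J: "J \<subseteq> {j \<in> T. a j \<noteq> 0}" "inj_on (\<lambda>j. scale (a j)) J" "E = (\<lambda>j. scale (a j)) ` J"
    unfolding scales_def subset_image_inj by blast
  have "prob J u (\<lambda>S. (\<Sum>j\<in>J. a j * pm S j) = m) \<le> (3 / 4) ^ D" for m
  proof -
    have "prob J u (\<lambda>S. (\<Sum>j\<in>J. a j * pm S j) = m) \<le> (3 / 4) ^ card J"
    proof (rule prob_sparse_scales[where e = "\<lambda>j. scale (a j)"])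
      show "finite J"
        using J T finite_subset by fastforce
    next
      fix j assume j: "j \<in> J"
      then show "2 powr scale (a j) \<le> \<bar>a j\<bar> \<and> \<bar>a j\<bar> < 2 powr (scale (a j) + 1)"
        using J(1) scale_bounds[of "a j"] by auto
      show "\<bar>u j\<bar> \<le> 1 / 2"
        using J(1) j u by auto
    next
      fix i j assume "i \<in> J" "j \<in> J"
      then show "even (scale (a i) - scale (a j))"
        using J(3) by (intro E(3)) auto
    qed (use J(2) in simp)
    also have "\<dots> \<le> (3 / 4) ^ D"
      using E(2) J by (intro power_decreasing) (auto simp: card_image)
    finally show ?thesis .
  qed
  then show ?thesis
  proof (intro prob_sum_eq_superset[OF T, where J = J])
    show "J \<subseteq> T"
      using J(1) by auto
    fix j assume "j \<in> T"
    then show "\<bar>u j\<bar> \<le> 1"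
      using u[of j] by simp
  qed
qed

section \<open>Light columns\<close>

definition scale_count :: "('a \<Rightarrow> real) \<Rightarrow> 'a set \<Rightarrow> int \<Rightarrow> nat" where
  "scale_count a T e = card {j \<in> T. a j \<noteq> 0 \<and> scale (a j) = e}"

text \<open>
  The potential bounds the total cost of deleting the columns of \<open>T\<close> one by one. While there are
  many scales it stays at the maximal value that it can have once there are only few.
\<close>
definition potential :: "nat \<Rightarrow> nat \<Rightarrow> ('a \<Rightarrow> real) \<Rightarrow> 'a set \<Rightarrow> real" where
  "potential D s a T = (if card (scales a T) < 2 * D then 4 * (\<Sum>e\<in>scales a T. sqrt (scale_count a T e))
     else 4 * sqrt (2 * D * s))"

text \<open>Rows with many scales are charged nothing because Bang's lemma is not applied to them. A
  row that vanishes on \<open>T\<close> costs 0.\<close>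

definition cost :: "nat \<Rightarrow> ('a \<Rightarrow> real) \<Rightarrow> 'a set \<Rightarrow> 'a \<Rightarrow> real" where
  "cost D a T j = (if card (scales a T) < 2 * D then \<bar>a j\<bar> / sqrt (\<Sum>i\<in>T. (a i)\<^sup>2) else 0)"

lemma potential_nonneg: "potential D s a T \<ge> 0"
  by (simp add: potential_def sum_nonneg)

text \<open>Cauchy-Schwarz over fewer than \<open>2 * D\<close> scales, whose counts add up to at
  most \<open>s\<close>.\<close>

lemma potential_le:
  assumes T: "finite T" and s: "card {j \<in> T. a j \<noteq> 0} \<le> s"
  shows "potential D s a T \<le> 4 * sqrt (2 * D * s)"
proof (cases "card (scales a T) < 2 * D")
  case True
  have "(\<Sum>e\<in>scales a T. sqrt (scale_count a T e))\<^sup>2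
      \<le> (\<Sum>e\<in>scales a T. (sqrt (scale_count a T e))\<^sup>2) * card (scales a T)"
    by (rule sum_squared_le_sum_of_squares)
  also have "(\<Sum>e\<in>scales a T. (sqrt (scale_count a T e))\<^sup>2) = real (card {j \<in> T. a j \<noteq> 0})"
  proof -
    have "card {j \<in> T. a j \<noteq> 0} = (\<Sum>e\<in>scales a T. scale_count a T e)"
      using sum.image_gen[of "{j \<in> T. a j \<noteq> 0}" "\<lambda>_. 1 :: nat" "\<lambda>j. scale (a j)"] T
      by (simp add: scales_def scale_count_def conj_assoc)
    then show ?thesis
      by simp
  qed
  also have "real (card {j \<in> T. a j \<noteq> 0}) * card (scales a T) \<le> real s * (2 * D)"
    using True s by (intro mult_mono) auto
  finally have "(\<Sum>e\<in>scales a T. sqrt (scale_count a T e)) \<le> sqrt (real s * (2 * D))"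
    by (rule real_le_rsqrt)
  then show ?thesis
    using True by (simp add: potential_def mult_ac)
qed (simp add: potential_def)

text \<open>
  If \<open>r\<close> entries of \<open>T\<close> share the scale of \<open>a\<^sub>j\<close>, the cost of \<open>j\<close> is at most
  \<open>2 / \<surd>r \<le> 4 (\<surd>r - \<surd>(r - 1))\<close>.
\<close>
lemma cost_le_potential_diff:
  assumes T: "finite T" and j: "j \<in> T" and s: "card {j \<in> T. a j \<noteq> 0} \<le> s"
  shows "cost D a T j \<le> potential D s a T - potential D s a (T - {j})"
proof (cases "card (scales a T) < 2 * D")
  case False
  \<comment> \<open>With many scales the cost is 0 and the potential is maximal, so deleting
    \<open>j\<close> cannot increase it.\<close>
  have "card {i \<in> T - {j}. a i \<noteq> 0} \<le> card {i \<in> T. a i \<noteq> 0}"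
    using T by (intro card_mono) auto
  then have "potential D s a (T - {j}) \<le> 4 * sqrt (2 * D * s)"
    using T s by (intro potential_le) auto
  then show ?thesis
    using False by (simp add: cost_def potential_def)
next
  case True
  have fin: "finite (scales a T)"
    using T by (simp add: scales_def)
  have sub: "scales a (T - {j}) \<subseteq> scales a T"
    by (auto simp: scales_def)
  then have "card (scales a (T - {j})) < 2 * D"
    using card_mono[OF fin sub] True by simp
  then have "potential D s a (T - {j}) = 4 * (\<Sum>e\<in>scales a (T - {j}). sqrt (scale_count a (T - {j}) e))"
    by (simp add: potential_def)
  also have "(\<Sum>e\<in>scales a (T - {j}). sqrt (scale_count a (T - {j}) e))
      = (\<Sum>e\<in>scales a T. sqrt (scale_count a (T - {j}) e))"
  \<comment> \<open>A scale that disappears with \<open>j\<close> has count 0 afterwards and may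
    stay in the sum.\<close>
  proof (rule sum.mono_neutral_left[OF fin sub], intro ballI)
    fix e assume "e \<in> scales a T - scales a (T - {j})"
    then have "{i \<in> T - {j}. a i \<noteq> 0 \<and> scale (a i) = e} = {}"
      by (auto simp: scales_def image_iff)
    then show "sqrt (scale_count a (T - {j}) e) = 0"
      by (simp only: scale_count_def card.empty) simp
  qed
  finally have diff: "potential D s a T - potential D s a (T - {j})
      = 4 * (\<Sum>e\<in>scales a T. sqrt (scale_count a T e) - sqrt (scale_count a (T - {j}) e))"
    using True by (simp add: potential_def sum_subtractf)
  have other: "scale_count a (T - {j}) e = scale_count a T e" if "a j = 0 \<or> scale (a j) \<noteq> e" for e
    unfolding scale_count_def using that by (intro arg_cong[where f = card]) auto
  show ?thesis
  proof (cases "a j = 0")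
    case True
    then show ?thesis
      unfolding diff using other by (simp add: cost_def)
  next
    case nz: False
    define e where "e = scale (a j)"
    define A where "A = {i \<in> T. a i \<noteq> 0 \<and> scale (a i) = e}"
    define r where "r = real (card A)"
    define N where "N = sqrt (\<Sum>i\<in>T. (a i)\<^sup>2)"
    have A: "finite A" "j \<in> A"
      using T j nz by (auto simp: A_def e_def)
    then have "card A \<ge> 1"
      by (metis One_nat_def Suc_leI card_gt_0_iff empty_iff)
    then have r: "r \<ge> 1"
      by (simp add: r_def)
    have cnt: "real (scale_count a T e) = r"
      by (simp add: scale_count_def r_def A_def)
    have "{i \<in> T - {j}. a i \<noteq> 0 \<and> scale (a i) = e} = A - {j}"
      by (auto simp: A_def)
    then have cnt': "real (scale_count a (T - {j}) e) = r - 1"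
      using A \<open>card A \<ge> 1\<close> by (simp add: scale_count_def r_def of_nat_diff)
    have "e \<in> scales a T"
      using j nz by (auto simp: scales_def e_def)
    then have "potential D s a T - potential D s a (T - {j}) = 4 * (sqrt r - sqrt (r - 1))"
      unfolding diff using fin other
      by (subst sum.remove[of _ e]) (auto simp: cnt cnt' e_def[symmetric] intro!: sum.neutral)
    moreover have "cost D a T j \<le> 2 / sqrt r"
    proof -
      \<comment> \<open>The \<open>r\<close> entries of this scale alone force the norm to be at
        least \<open>sqrt r * 2 powr e\<close>, while the entry at \<open>j\<close> is at most twice
        \<open>2 powr e\<close>.\<close>
      have "r * (2 powr e)\<^sup>2 = (\<Sum>i\<in>A. (2 powr e)\<^sup>2)"
        by (simp add: r_def)
      also have "\<dots> \<le> (\<Sum>i\<in>A. (a i)\<^sup>2)"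
      proof (rule sum_mono)
        fix i assume "i \<in> A"
        then have "2 powr e \<le> \<bar>a i\<bar>"
          using scale_bounds(1)[of "a i"] by (auto simp: A_def)
        then show "(2 powr e)\<^sup>2 \<le> (a i)\<^sup>2"
          using power_mono[of "2 powr real_of_int e" "\<bar>a i\<bar>" 2] by simp
      qed
      also have "\<dots> \<le> (\<Sum>i\<in>T. (a i)\<^sup>2)"
        using T by (intro sum_mono2) (auto simp: A_def)
      finally have "sqrt (r * (2 powr e)\<^sup>2) \<le> N"
        unfolding N_def by simp
      then have N: "sqrt r * 2 powr e \<le> N"
        by (simp add: real_sqrt_mult)
      have "\<bar>a j\<bar> \<le> 2 * 2 powr e"
        using scale_bounds(2)[OF nz] by (simp add: e_def powr_add)
      moreover have "0 < sqrt r * 2 powr e"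
        using r by simp
      ultimately have "\<bar>a j\<bar> / N \<le> 2 * 2 powr e / (sqrt r * 2 powr e)"
        using N by (intro frac_le) auto
      then show ?thesis
        using True by (simp add: cost_def N_def)
    qed
    moreover have "2 / sqrt r \<le> 4 * (sqrt r - sqrt (r - 1))"
    proof -
      \<comment> \<open>The mean inequality for \<open>r\<close> and \<open>r - 1\<close>; the claim
        follows after multiplication by \<open>sqrt r\<close>.\<close>
      have "sqrt r * sqrt (r - 1) \<le> r - 1 / 2"
      proof -
        have "sqrt (r * (r - 1)) \<le> sqrt ((r - 1 / 2)\<^sup>2)"
          by (simp add: power2_eq_square field_simps)
        then show ?thesis
          using r by (simp add: real_sqrt_mult)
      qed
      moreover have "4 * (sqrt r - sqrt (r - 1)) * sqrt r = 4 * (r - sqrt r * sqrt (r - 1))"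
        using r by (simp add: algebra_simps)
      ultimately show ?thesis
        using r by (subst pos_divide_le_eq) auto
    qed
    ultimately show ?thesis
      by linarith
  qed
qed

text \<open>Otherwise heavy columns could be deleted until none is left. The costs, each above
  \<open>h\<close>, telescope to at most the initial potential, contradicting
  \<open>big\<close>.\<close>

lemma exists_light_subset:
  fixes v :: "'i \<Rightarrow> 'a \<Rightarrow> real" and h :: real
  assumes V: "finite V" and s: "\<And>i. i \<in> I \<Longrightarrow> card {j \<in> V. v i j \<noteq> 0} \<le> s"
    and big: "card I * (4 * sqrt (2 * D * s)) < h * card V"
  shows "\<exists>T\<subseteq>V. T \<noteq> {} \<and> (\<forall>j\<in>T. (\<Sum>i\<in>I. cost D (v i) T j) \<le> h)"
proof (rule ccontr)
  assume "\<not> ?thesis"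
  then have heavy: "\<exists>j\<in>T. h < (\<Sum>i\<in>I. cost D (v i) T j)" if "T \<subseteq> V" "T \<noteq> {}" for T
    using that by (meson not_le)
  have "h * card T \<le> (\<Sum>i\<in>I. potential D s (v i) T)" if "T \<subseteq> V" for T
    using finite_subset[OF that V] that
  proof (induction T rule: finite_psubset_induct)
    case (psubset T)
    show ?case
    proof (cases "T = {}")
      case True
      then show ?thesis
        by (simp add: sum_nonneg potential_nonneg)
    next
      case False
      then obtain j where j: "j \<in> T" "h < (\<Sum>i\<in>I. cost D (v i) T j)"
        using heavy[of T] psubset.prems by auto
      have "h * card T = h * card (T - {j}) + h"
        using j psubset.hyps card.remove[of T j] by (simp add: algebra_simps del: card_Diff_insert)
      also have "\<dots> \<le> (\<Sum>i\<in>I. potential D s (v i) (T - {j})) + (\<Sum>i\<in>I. cost D (v i) T j)"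
        using j psubset.prems by (intro add_mono psubset.IH) auto
      also have "\<dots> \<le> (\<Sum>i\<in>I. potential D s (v i) T)"
        unfolding sum.distrib[symmetric]
      proof (rule sum_mono)
        fix i assume i: "i \<in> I"
        have "card {j \<in> T. v i j \<noteq> 0} \<le> card {j \<in> V. v i j \<noteq> 0}"
          using V psubset.prems by (intro card_mono) auto
        also have "\<dots> \<le> s"
          using s i by simp
        finally show "potential D s (v i) (T - {j}) + cost D (v i) T j \<le> potential D s (v i) T"
          using cost_le_potential_diff[of T j "v i" s D] psubset.hyps j by simp
      qed
      finally show ?thesis .
    qed
  qed
  then have "h * card V \<le> (\<Sum>i\<in>I. potential D s (v i) V)"
    by simp
  also have "\<dots> \<le> card I * (4 * sqrt (2 * D * s))"
    using V s by (intro sum_bounded_above potential_le) auto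
  finally show False
    using big by simp
qed


section \<open>The lower bound\<close>

text \<open>Here \<open>q\<close> bounds the failure probability of each single row, so
  \<open>k * q < 1\<close> lets the union bound produce an uncovered vertex.\<close>

lemma essential_cover_no_light_subset:
  assumes ec: "essential_cover n k v mu"
    and T: "T \<subseteq> {..<n}" "T \<noteq> {}" and \<theta>: "\<theta> > 0"
    and light: "\<And>j. j \<in> T \<Longrightarrow> (\<Sum>i<k. cost D (v i) T j) \<le> 1 / (2 * \<theta>)"
    and q: "2 * exp (- (\<theta>\<^sup>2 / 9)) \<le> q" "(3 / 4) ^ D \<le> q" "real k * q < 1"
  shows False
proof -
  have finT: "finite T"
    using T(1) finite_subset by blast
  obtain j0 where j0: "j0 \<in> T"
    using T(2) by blast
  then have "j0 < n"
    using T(1) by auto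
  then obtain i0 where i0: "i0 < k" "v i0 j0 \<noteq> 0"
    using ec unfolding essential_cover_def by meson
  \<comment> \<open>The private vertex of a row \<open>i0\<close> that is nonzero on
    \<open>T\<close>: every hyperplane whose normal vanishes on \<open>T\<close> differs from that
    of \<open>i0\<close> and hence misses \<open>y\<close>.\<close>
  obtain y where y: "y \<in> hypercube n"
    and y_off: "\<And>i. i < k \<Longrightarrow> i \<noteq> i0 \<Longrightarrow> \<not> on_hyperplane n (v i) (mu i) y"
    using ec i0(1) unfolding essential_cover_def by meson
  define off where "off i = (\<Sum>j\<in>{..<n} - T. v i j * y j)" for i
  define N where "N i = sqrt (\<Sum>j\<in>T. (v i j)\<^sup>2)" for i
  define I where "I = {i \<in> {..<k}. card (scales (v i) T) < 2 * D \<and> (\<exists>j\<in>T. v i j \<noteq> 0)}"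
  define w where "w i j = v i j / N i" for i j
  \<comment> \<open>The Gram matrix of the unit vectors \<open>w i\<close>, scaled so that the
    diagonal on \<open>I\<close> is \<open>\<theta>\<close>.\<close>
  define M where "M i l = \<theta> * (\<Sum>j\<in>T. w i j * w l j)" for i l
  have finI: "finite I"
    by (simp add: I_def)
  have N: "N i > 0" if i: "i \<in> I" for i
  proof -
    obtain j where "j \<in> T" "v i j \<noteq> 0"
      using i by (auto simp: I_def)
    then have "0 < (\<Sum>j\<in>T. (v i j)\<^sup>2)"
      using finT by (intro sum_pos2[of T j]) auto
    then show ?thesis
      by (simp add: N_def)
  qed
  have w_norm: "(\<Sum>j\<in>T. (w i j)\<^sup>2) = 1" if "i \<in> I" for i
  proof -
    have "(\<Sum>j\<in>T. (w i j)\<^sup>2) = (\<Sum>j\<in>T. (v i j)\<^sup>2) / (N i)\<^sup>2"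
      by (simp add: w_def power_divide sum_divide_distrib)
    also have "(\<Sum>j\<in>T. (v i j)\<^sup>2) = (N i)\<^sup>2"
      by (simp add: N_def sum_nonneg)
    finally show ?thesis
      using N[OF that] by simp
  qed
  have M_sym: "M i l = M l i" for i l
    by (simp add: M_def mult.commute)
  obtain \<epsilon> where \<epsilon>: "\<And>i. \<epsilon> i = 1 \<or> \<epsilon> i = -1"
    and far: "\<And>i. i \<in> I \<Longrightarrow> \<bar>(\<Sum>l\<in>I. M i l * \<epsilon> l) - (mu i - off i) / N i\<bar> \<ge> M i i"
    using Bang[where M = M and m = "\<lambda>i. (mu i - off i) / N i", OF finI M_sym] by blast
  \<comment> \<open>Bang's point: its inner product with \<open>w i\<close> is the row sum of
    \<open>M\<close> in \<open>far\<close>. Lightness of \<open>T\<close> places it in the cube of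
    half-width 1/2.\<close>
  define u where "u j = \<theta> * (\<Sum>l\<in>I. w l j * \<epsilon> l)" for j
  have M_u: "(\<Sum>l\<in>I. M i l * \<epsilon> l) = (\<Sum>j\<in>T. w i j * u j)" for i
    unfolding M_def u_def sum_distrib_left sum_distrib_right
    by (subst sum.swap) (simp add: mult_ac)
  have u: "\<bar>u j\<bar> \<le> 1 / 2" if j: "j \<in> T" for j
  proof -
    have "\<bar>\<Sum>l\<in>I. w l j * \<epsilon> l\<bar> \<le> (\<Sum>l\<in>I. cost D (v l) T j)"
    proof (rule order_trans[OF sum_abs], rule sum_mono)
      fix l assume l: "l \<in> I"
      have "\<bar>\<epsilon> l\<bar> = 1"
        using \<epsilon>[of l] by auto
      then show "\<bar>w l j * \<epsilon> l\<bar> \<le> cost D (v l) T j"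
        using l N[OF l] by (simp add: abs_mult w_def cost_def I_def N_def)
    qed
    also have "\<dots> \<le> (\<Sum>l<k. cost D (v l) T j)"
      by (intro sum_mono2) (auto simp: I_def cost_def sum_nonneg)
    also have "\<dots> \<le> 1 / (2 * \<theta>)"
      using light j .
    finally have "\<theta> * \<bar>\<Sum>l\<in>I. w l j * \<epsilon> l\<bar> \<le> \<theta> * (1 / (2 * \<theta>))"
      using \<theta> by (intro mult_left_mono) auto
    then show ?thesis
      using \<theta> by (simp add: u_def abs_mult)
  qed
  \<comment> \<open>Bad events. A few-scale row vanishing on \<open>T\<close> gets the empty event,
    since \<open>y\<close> already deals with it.\<close>
  define E where "E i S \<longleftrightarrow>
    (if i \<in> I then \<bar>\<Sum>j\<in>T. w i j * (pm S j - u j)\<bar> \<ge> \<theta>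
     else 2 * D \<le> card (scales (v i) T) \<and> (\<Sum>j\<in>T. v i j * pm S j) = mu i - off i)" for i S
  have "prob T u (E i) \<le> q" for i
  proof (cases "i \<in> I")
    case True
    then have "prob T u (E i) = prob T u (\<lambda>S. \<bar>\<Sum>j\<in>T. w i j * (pm S j - u j)\<bar> \<ge> \<theta>)"
      by (simp add: prob_def E_def)
    also have "\<dots> \<le> 2 * exp (- (\<theta>\<^sup>2 / 9))"
      using finT u \<theta> w_norm[OF True] by (intro prob_abs_ge) auto
    finally show ?thesis
      using q(1) by simp
  next
    case notI: False
    show ?thesis
    proof (cases "2 * D \<le> card (scales (v i) T)")
      case True
      then have "prob T u (E i) = prob T u (\<lambda>S. (\<Sum>j\<in>T. v i j * pm S j) = mu i - off i)"
        using notI by (simp add: prob_def E_def)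
      also have "\<dots> \<le> (3 / 4) ^ D"
        using finT u True by (intro prob_many_scales) auto
      finally show ?thesis
        using q(2) by simp
    next
      case False
      then have "prob T u (E i) = 0"
        using notI by (simp add: prob_def E_def)
      moreover have "0 \<le> exp (- (\<theta>\<^sup>2 / 9))"
        by simp
      ultimately show ?thesis
        using q(1) by linarith
    qed
  qed
  then have "(\<Sum>i<k. prob T u (E i)) \<le> real k * q"
    using sum_bounded_above[of "{..<k}" "\<lambda>i. prob T u (E i)" q] by simp
  then have "(\<Sum>i<k. prob T u (E i)) < 1"
    using q(3) by simp
  moreover have "\<bar>u j\<bar> \<le> 1" if "j \<in> T" for j
    using u[OF that] by simp
  ultimately obtain S where S: "\<And>i. i < k \<Longrightarrow> \<not> E i S"
    using exists_avoiding[OF finT finite_lessThan] by (metis lessThan_iff)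
  define x where "x j = (if j \<in> T then pm S j else y j)" for j
  have "x \<in> hypercube n"
    using y T(1) by (auto simp: hypercube_def x_def pm_def)
  then obtain i where i: "i < k" "on_hyperplane n (v i) (mu i) x"
    using ec unfolding essential_cover_def by blast
  have split: "(\<Sum>j<n. v i j * z j) = (\<Sum>j\<in>T. v i j * z j) + (\<Sum>j\<in>{..<n} - T. v i j * z j)" for z
    using T(1) by (subst sum.subset_diff[of T]) (auto simp: add.commute)
  have "(\<Sum>j<n. v i j * x j) = (\<Sum>j\<in>T. v i j * pm S j) + off i"
    unfolding split by (simp add: x_def off_def)
  then have on: "(\<Sum>j\<in>T. v i j * pm S j) = mu i - off i"
    using i(2) by (simp add: on_hyperplane_def)
  consider "i \<in> I" | "2 * D \<le> card (scales (v i) T)" "i \<notin> I" | "\<forall>j\<in>T. v i j = 0"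
    using i(1) by (fastforce simp: I_def)
  then show False
  proof cases
    case 1
    \<comment> \<open>Lying on hyperplane \<open>i\<close> would require a deviation from
      \<open>u\<close> of at least the distance \<open>\<theta>\<close>, which is the excluded
      event.\<close>
    have "(\<Sum>j\<in>T. w i j * pm S j) = (mu i - off i) / N i"
      by (simp add: w_def on[symmetric] sum_divide_distrib)
    then have "(\<Sum>j\<in>T. w i j * (pm S j - u j)) = (mu i - off i) / N i - (\<Sum>l\<in>I. M i l * \<epsilon> l)"
      unfolding M_u by (simp add: right_diff_distrib sum_subtractf)
    moreover have "M i i = \<theta>"
      using w_norm[OF 1] by (simp add: M_def power2_eq_square)
    ultimately have "\<bar>\<Sum>j\<in>T. w i j * (pm S j - u j)\<bar> \<ge> \<theta>"
      using far[OF 1] by linarith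
    then show False
      using S[OF i(1)] 1 by (simp add: E_def)
  next
    case 2
    then show False
      using S[OF i(1)] on by (simp add: E_def)
  next
    case 3
    have "(\<Sum>j<n. v i j * y j) = mu i"
      unfolding split using 3 on by (simp add: off_def)
    moreover have "i \<noteq> i0"
      using 3 i0(2) j0 by auto
    ultimately show False
      using y_off[OF i(1)] by (simp add: on_hyperplane_def)
  qed
qed

lemma essential_cover_bound:
  assumes n: "n \<ge> 2" and ec: "essential_cover n k v mu"
  shows "real n \<le> 1000 * real k powr (3 / 2) * ln n"
proof (rule ccontr)
  assume "\<not> ?thesis"
  then have large: "real n > 1000 * real k powr (3 / 2) * ln n"
    by simp
  have "k > 0"
  proof -
    have "(\<lambda>j. if j < n then 1 else 0) \<in> hypercube n"
      by (auto simp: hypercube_def)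
    then show ?thesis
      using ec unfolding essential_cover_def by fastforce
  qed
  \<comment> \<open>A crude bound that gives \<open>n > 500 * k\<close>; this in turn improves it to
    \<open>ln n \<ge> 1\<close>.\<close>
  have ln2: "ln (real n) \<ge> 1 / 2"
  proof -
    have "exp (1 / 2 :: real) \<le> 1 + 1 / 2 + (1 / 2)\<^sup>2"
      by (rule exp_bound) auto
    also have "\<dots> \<le> real n"
      using n by (simp add: power2_eq_square)
    finally show ?thesis
      using n by (subst ln_ge_iff) auto
  qed
  have k_powr: "real k powr (3 / 2) = real k * sqrt k"
  proof -
    have "real k powr (3 / 2) = real k powr (1 + 1 / 2)"
      by simp
    also have "\<dots> = real k * sqrt k"
      unfolding powr_add using \<open>k > 0\<close> by (simp add: powr_half_sqrt)
    finally show ?thesis .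
  qed
  have "500 * real k \<le> 1000 * real k powr (3 / 2) * ln n"
  proof -
    have "500 * real k = 1000 * (real k * 1) * (1 / 2)"
      by simp
    also have "\<dots> \<le> 1000 * (real k * sqrt k) * ln n"
      using ln2 \<open>k > 0\<close> by (intro mult_mono) auto
    finally show ?thesis
      by (simp add: k_powr)
  qed
  then have nk: "real n > 500 * real k"
    using large by linarith
  have ln1: "ln (real n) \<ge> 1"
  proof -
    have "exp (1 :: real) \<le> 500"
      using e_less_272 by simp
    then have "exp 1 \<le> real n"
      using nk \<open>k > 0\<close> by linarith
    then show ?thesis
      using n by (subst ln_ge_iff) auto
  qed
  \<comment> \<open>Both choices push the failure probability of a row down to \<open>2 / n\<close>:
    the tail exponent becomes \<open>ln n\<close>, and \<open>3 / 4 \<le> exp (- (1 / 4))\<close>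
    calls for \<open>4 * ln n\<close> scales.\<close>
  define \<theta> where "\<theta> = 3 * sqrt (ln n)"
  define D where "D = nat \<lceil>4 * ln n\<rceil>"
  have D: "4 * ln n \<le> real D" "real D \<le> 5 * ln n"
    using ln1 unfolding D_def by linarith+
  have \<theta>: "\<theta> > 0" "\<theta>\<^sup>2 / 9 = ln n"
    using ln1 by (auto simp: \<theta>_def power_mult_distrib)
  have supp: "card {j \<in> {..<n}. v i j \<noteq> 0} \<le> 2 * k" if "i \<in> {..<k}" for i
    using essential_cover_card_support[OF ec] that by simp
  \<comment> \<open>The deletion budget with support bound \<open>2 * k\<close>. Rounding 20 up to
    the square 25 gives the constant 2 * 3 * 4 * 5 = 120, well below 1000.\<close>
  have "2 * \<theta> * (card {..<k} * (4 * sqrt (2 * real D * real (2 * k)))) < card {..<n}"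
  proof -
    have "sqrt (2 * real D * real (2 * k)) \<le> sqrt (25 * (ln n * k))"
    proof -
      have "0 \<le> ln n * real k"
        using ln1 by simp
      then show ?thesis
        using mult_right_mono[OF D(2), of "real k"] by simp
    qed
    also have "\<dots> = 5 * (sqrt (ln n) * sqrt k)"
      by (simp add: real_sqrt_mult)
    finally have "2 * \<theta> * (real k * (4 * sqrt (2 * real D * real (2 * k))))
        \<le> 2 * \<theta> * (real k * (4 * (5 * (sqrt (ln n) * sqrt k))))"
      using \<theta> by (intro mult_left_mono) auto
    also have "\<dots> = 120 * (real k * sqrt k) * (sqrt (ln n) * sqrt (ln n))"
      by (simp add: \<theta>_def)
    also have "\<dots> = 120 * (real k * sqrt k) * ln n"
      using ln1 by simp
    also have "\<dots> \<le> 1000 * (real k * sqrt k) * ln n"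
      using ln1 by (intro mult_right_mono) auto
    finally show ?thesis
      using large by (simp add: k_powr)
  qed
  then have few: "card {..<k} * (4 * sqrt (2 * real D * real (2 * k))) < 1 / (2 * \<theta>) * card {..<n}"
    using \<theta> by (simp add: field_simps)
  obtain T where T: "T \<subseteq> {..<n}" "T \<noteq> {}"
    "\<And>j. j \<in> T \<Longrightarrow> (\<Sum>i<k. cost D (v i) T j) \<le> 1 / (2 * \<theta>)"
    using exists_light_subset[where v = v, OF finite_lessThan supp few] by auto
  show False
  proof (rule essential_cover_no_light_subset[OF ec T(1,2) \<theta>(1) T(3)])
    show "2 * exp (- (\<theta>\<^sup>2 / 9)) \<le> 2 / real n"
      unfolding \<theta>(2) using n by (simp add: exp_minus field_simps)
    have "(3 / 4 :: real) \<le> exp (- (1 / 4))"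
      using exp_ge_add_one_self[of "- (1 / 4)"] by simp
    then have "(3 / 4) ^ D \<le> exp (- (1 / 4) :: real) ^ D"
      by (intro power_mono) auto
    also have "\<dots> = exp (- (D / 4))"
      using exp_of_nat_mult[of D "- (1 / 4) :: real"] by simp
    also have "\<dots> \<le> exp (- ln n)"
      using D(1) by simp
    also have "\<dots> = 1 / real n"
      using n by (simp add: exp_minus field_simps)
    also have "\<dots> \<le> 2 / real n"
      by (simp add: divide_right_mono)
    finally show "(3 / 4) ^ D \<le> 2 / real n" .
    show "real k * (2 / real n) < 1"
      using nk n by (simp add: field_simps)
  qed
qed

theorem mainTheorem1:
  fixes n k :: nat and v :: "nat \<Rightarrow> nat \<Rightarrow> real" and mu :: "nat \<Rightarrow> real"
  assumes "n \<ge> 2"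
    and "essential_cover n k v mu"
  shows "real k \<ge> 10 powr (-2) * real n powr (2/3) / ln (real n) powr (2/3)"
proof -
  have ln: "ln (real n) > 0"
    using assms(1) by simp
  \<comment> \<open>Raising to the power 2/3 turns 1000 into 100, the reciprocal of the stated
    constant.\<close>
  have "real n / ln n \<le> 1000 * real k powr (3 / 2)"
    using essential_cover_bound[OF assms] ln by (simp add: divide_le_eq)
  then have "(real n / ln n) powr (2 / 3) \<le> (1000 * real k powr (3 / 2)) powr (2 / 3)"
    using ln by (intro powr_mono2) auto
  also have "\<dots> = 1000 powr (2 / 3) * real k"
    by (simp add: powr_mult powr_powr)
  also have "(1000 :: real) powr (2 / 3) = 100"
  proof -
    have "(1000 :: real) powr (2 / 3) = (10 powr 3) powr (2 / 3)"
      by simp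
    also have "\<dots> = 100"
      unfolding powr_powr by simp
    finally show ?thesis .
  qed
  finally have "(real n / ln n) powr (2 / 3) / 100 \<le> real k"
    by simp
  moreover have "(10 :: real) powr (-2) = 1 / 100"
    by (simp add: powr_minus)
  ultimately show ?thesis
    using ln by (simp only: powr_divide) simp
qed

end
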